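(* Let $F$ be the fractal percolation in $[0,1]^2$ with parameters $M\in\mathbb{N}_{\geq 2}$ and $p\in(1/M^2,1]$, let $D=\log(M^2p)/\log M$, $r=1/M$, and $\overline{\mathcal V}_k(F):=\lim_{n\to\infty} r^{n(D-k)}\mathbb{E}V_k(F_n)$. Then these limits exist and $$\overline{\mathcal V}_2(F)=1,\qquad \overline{\mathcal V}_1(F)=\frac{2M(1-p)}{M-p},$$ $$\overline{\mathcal V}_0(F)=1-\frac{2p(M-1)^2}{M-p}\left(\frac{3}{M-1}-\frac{4p}{M-p}+\frac{p^2}{M-p^2}\right)+\frac{2p(M^2-1)}{M^2-p}-\frac{4p^2(M-1)^2}{(M-p)^2}+\frac{p^3(M-1)^2(M+p^2)}{(M-p^2)(M^2-p^3)}.$$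
   Context: Fractal percolation in $[0,1]^d$ (here $d=2$) with parameters $M\geq2$, $p\in[0,1]$: $F_0:=[0,1]^d$; given $F_{n-1}$, a union of closed grid cubes of side $M^{-(n-1)}$, each such cube is divided into $M^d$ closed subcubes of side $M^{-n}$, each kept independently (of everything else) with probability $p$; $F_n$ is the union of kept subcubes, $F=\bigcap_n F_n$. $V_0,V_1,V_2$ are the intrinsic volumes (Euler characteristic, half the perimeter, area) extended additively to finite unions of compact convex sets. *)

theory Defs
  imports "HOL-Analysis.Analysis" "HOL-Probability.Probability"
begin

(* Intrinsic volumes V_0 (Euler characteristic), V_1 (half perimeter), V_2 (area)
   of a (possibly degenerate or empty) closed axis-parallel rectangle in R^2.
   All sets to which this is applied below are such rectangles. *)
definition box_iv :: "nat \<Rightarrow> (real \<times> real) set \<Rightarrow> real" where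
  "box_iv k S =
     (if S = {} then 0
      else if k = 0 then 1
      else if k = 1 then (Sup (fst ` S) - Inf (fst ` S)) + (Sup (snd ` S) - Inf (snd ` S))
      else measure lebesgue S)"

(* Additive extension (inclusion-exclusion) of V_k to the union of a finite
   family of closed axis-parallel rectangles. *)
definition union_iv :: "nat \<Rightarrow> (real \<times> real) set set \<Rightarrow> real" where
  "union_iv k \<A> =
     (\<Sum>\<I>\<in>{\<I>. \<I> \<subseteq> \<A> \<and> \<I> \<noteq> {}}. (-1) ^ (card \<I> + 1) * box_iv k (\<Inter>\<I>))"

definition grid_cell :: "nat \<Rightarrow> nat \<Rightarrow> nat \<Rightarrow> nat \<Rightarrow> (real \<times> real) set" where
  "grid_cell M n a b =
     cbox (real a / real M ^ n, real b / real M ^ n)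
          ((real a + 1) / real M ^ n, (real b + 1) / real M ^ n)"

definition cells_upto :: "nat \<Rightarrow> nat \<Rightarrow> (nat \<times> nat \<times> nat) set" where
  "cells_upto M n = {(j, a, b). 1 \<le> j \<and> j \<le> n \<and> a < M ^ j \<and> b < M ^ j}"

(* the family of level-n squares forming F_n: a level-n cell belongs to F_n iff
   it and all its ancestors at levels 1..n were kept *)
definition perc_family ::
    "nat \<Rightarrow> nat \<Rightarrow> (nat \<times> nat \<times> nat \<Rightarrow> bool) \<Rightarrow> (real \<times> real) set set" where
  "perc_family M n \<omega> =
     {grid_cell M n a b | a b. a < M ^ n \<and> b < M ^ n \<and>
        (\<forall>j\<in>{1..n}. \<omega> (j, a div M ^ (n - j), b div M ^ (n - j)))}"

definition expected_iv :: "nat \<Rightarrow> real \<Rightarrow> nat \<Rightarrow> nat \<Rightarrow> real" where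
  "expected_iv M p k n =
     measure_pmf.expectation (Pi_pmf (cells_upto M n) False (\<lambda>_. bernoulli_pmf p))
       (\<lambda>\<omega>. union_iv k (perc_family M n \<omega>))"

end

theory Submission
  imports Defs
begin

text \<open>
  Cut the unit square into the vertices, open edges and open faces of the level-\<open>n\<close> grid. By
  inclusion-exclusion, \<open>V\<^sub>k(F\<^sub>n)\<close> is a weighted count of the pieces covered by \<open>F\<^sub>n\<close>, with weights that are
  sums of products of one-dimensional weights. The probability that a vertex on the grid lines \<open>x\<close> and \<open>y\<close>
  is covered depends only on the \<open>M\<close>-adic valuations of \<open>x\<close> and \<open>y\<close>, which determine how many ancestors
  the surrounding cells share. Since valuation \<open>k - 1\<close> occurs with frequency \<open>(M - 1) / M ^ k\<close>, the
  rescaled expectations are partial sums of geometric series.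
\<close>

section \<open>Intrinsic volumes as weighted counts of grid pieces\<close>

text \<open>On a box, each \<open>V_k\<close> is bilinear in the Euler characteristics and lengths
  of its two sides, and both of these are sums over the vertices and open edges of an axis. So
  \<open>V_k\<close> becomes a finite signed measure on grid pieces. The alternating sum over all
  subfamilies of squares in \<open>union_iv\<close>, which is intractable under an expectation,
  collapses to one indicator per piece. A piece meets at most four cells, so inclusion-exclusion is
  needed for four events only. The normalisation matches this count.
  \<open>M^(n D) = (M^2 p)^n\<close> is the expected number of squares in \<open>F_n\<close>. Each
  Euler characteristic sum over an axis has size \<open>M^n\<close>, each length sum has size 1, and
  every covering probability carries \<open>p^n\<close>. Hence \<open>V_k\<close>, with
  \<open>2 - k\<close> Euler characteristic factors, has order \<open>p^n M^(n (2 - k))\<close>,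
  which the factor \<open>r^(n (D - k))\<close> cancels exactly.\<close>

text \<open>Doubled coordinates: the point \<open>(i, j)\<close> stands for the vertex, open edge or open face of the
  level-\<open>n\<close> grid centred at \<open>(i s / 2, j s / 2)\<close>, with \<open>s\<close> the mesh size and odd coordinates for the
  extended directions. \<open>iv_wt s k\<close> is the additive \<open>V\<^sub>k\<close> of this relatively open piece,
  so an open face has \<open>V\<^sub>1 = 2 s - 4 s\<close>.\<close>

definition chi_wt :: "nat \<Rightarrow> real" where "chi_wt i = (-1) ^ i"
definition len_wt :: "real \<Rightarrow> nat \<Rightarrow> real" where "len_wt s i = (if odd i then s else 0)"
definition iv_wt :: "real \<Rightarrow> nat \<Rightarrow> nat \<times> nat \<Rightarrow> real" where
  "iv_wt s k = (\<lambda>(i, j).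
     if k = 0 then chi_wt i * chi_wt j
     else if k = 1 then len_wt s i * chi_wt j + chi_wt i * len_wt s j
     else len_wt s i * len_wt s j)"
definition cell_pts :: "nat \<Rightarrow> nat set" where "cell_pts a = {2 * a..2 * a + 2}"

section \<open>Intersections of grid cells, axis by axis\<close>

lemma INT_cell_pts:
  assumes "finite A" "A \<noteq> {}"
  shows "(\<Inter>a\<in>A. cell_pts a) = {2 * Max A..2 * Min A + 2}"
proof (rule set_eqI)
  fix i
  have "i \<in> (\<Inter>a\<in>A. cell_pts a) \<longleftrightarrow> (\<forall>a\<in>A. 2 * a \<le> i) \<and> (\<forall>a\<in>A. i \<le> 2 * a + 2)"
    by (auto simp: cell_pts_def)
  also have "(\<forall>a\<in>A. 2 * a \<le> i) \<longleftrightarrow> 2 * Max A \<le> i"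
    using Max_in[OF assms] by (meson Max_ge assms(1) le_trans mult_le_mono2)
  also have "(\<forall>a\<in>A. i \<le> 2 * a + 2) \<longleftrightarrow> i \<le> 2 * Min A + 2"
    using Min_in[OF assms] by (meson Min_le assms(1) le_trans mult_le_mono2 add_le_mono1)
  finally show "i \<in> (\<Inter>a\<in>A. cell_pts a) \<longleftrightarrow> i \<in> {2 * Max A..2 * Min A + 2}" by simp
qed

lemma INT_interval:
  fixes s :: real
  assumes "finite A" "A \<noteq> {}" "s > 0"
  shows "(\<Inter>a\<in>A. {real a * s..(real a + 1) * s}) = {real (Max A) * s..(real (Min A) + 1) * s}"
proof (rule set_eqI)
  fix t
  have "t \<in> (\<Inter>a\<in>A. {real a * s..(real a + 1) * s}) \<longleftrightarrow>
      (\<forall>a\<in>A. real a * s \<le> t) \<and> (\<forall>a\<in>A. t \<le> (real a + 1) * s)"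
    by auto
  also have "(\<forall>a\<in>A. real a * s \<le> t) \<longleftrightarrow> real (Max A) * s \<le> t"
  proof
    assume t: "real (Max A) * s \<le> t"
    show "\<forall>a\<in>A. real a * s \<le> t"
    proof
      fix a assume "a \<in> A"
      then have "real a * s \<le> real (Max A) * s" using assms by (intro mult_right_mono) auto
      with t show "real a * s \<le> t" by linarith
    qed
  qed (use assms in auto)
  also have "(\<forall>a\<in>A. t \<le> (real a + 1) * s) \<longleftrightarrow> t \<le> (real (Min A) + 1) * s"
  proof
    assume t: "t \<le> (real (Min A) + 1) * s"
    show "\<forall>a\<in>A. t \<le> (real a + 1) * s"
    proof
      fix a assume "a \<in> A"
      then have "(real (Min A) + 1) * s \<le> (real a + 1) * s" using assms by (intro mult_right_mono) auto
      with t show "t \<le> (real a + 1) * s" by linarith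
    qed
  qed (use assms in auto)
  finally show "t \<in> (\<Inter>a\<in>A. {real a * s..(real a + 1) * s}) \<longleftrightarrow>
    t \<in> {real (Max A) * s..(real (Min A) + 1) * s}" by simp
qed

text \<open>Here \<open>k\<close> and \<open>m\<close> are the extreme columns of an intersection. A
  single column contributes vertex, edge, vertex with signs 1 - 1 + 1, neighbouring columns share
  one vertex, and columns further apart share nothing.\<close>

lemma sum_wt_cell_pts:
  fixes s :: real
  assumes "k \<le> m" "s > 0"
  shows "(\<Sum>i\<in>{2 * m..2 * k + 2}. chi_wt i) = (if {real m * s..(real k + 1) * s} = {} then 0 else 1)"
    and "(\<Sum>i\<in>{2 * m..2 * k + 2}. len_wt s i) =
           (if {real m * s..(real k + 1) * s} = {} then 0 else (real k + 1) * s - real m * s)"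
proof -
  consider "m = k" | "m = Suc k" | "m > Suc k" using assms by linarith
  then have "(\<Sum>i\<in>{2 * m..2 * k + 2}. chi_wt i) = (if {real m * s..(real k + 1) * s} = {} then 0 else 1) \<and>
    (\<Sum>i\<in>{2 * m..2 * k + 2}. len_wt s i) =
           (if {real m * s..(real k + 1) * s} = {} then 0 else (real k + 1) * s - real m * s)"
  proof cases
    case 1
    then have "{2 * m..2 * k + 2} = {2 * k, 2 * k + 1, 2 * k + 2}" by auto
    with 1 assms show ?thesis by (simp add: chi_wt_def len_wt_def algebra_simps)
  next
    case 2
    then have "{2 * m..2 * k + 2} = {2 * k + 2}" by auto
    with 2 assms show ?thesis by (simp add: chi_wt_def len_wt_def algebra_simps)
  next
    case 3
    then have "real m > real k + 1" by linarith
    with assms have "real m * s > (real k + 1) * s" by simp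
    moreover from 3 have "{2 * m..2 * k + 2} = {}" by auto
    ultimately show ?thesis by simp
  qed
  then show "(\<Sum>i\<in>{2 * m..2 * k + 2}. chi_wt i) = (if {real m * s..(real k + 1) * s} = {} then 0 else 1)"
    and "(\<Sum>i\<in>{2 * m..2 * k + 2}. len_wt s i) =
           (if {real m * s..(real k + 1) * s} = {} then 0 else (real k + 1) * s - real m * s)" by auto
qed

lemma box_iv_rectangle:
  fixes x y :: real
  shows "box_iv k ({x..x'} \<times> {y..y'}) =
    (if {x..x'} = {} \<or> {y..y'} = {} then 0
     else if k = 0 then 1
     else if k = 1 then (x' - x) + (y' - y) else (x' - x) * (y' - y))"
proof (cases "x \<le> x' \<and> y \<le> y'")
  case True
  have "{x..x'} \<times> {y..y'} = cbox (x, y) (x', y')" by (simp add: cbox_Pair_eq)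
  then have "measure lebesgue ({x..x'} \<times> {y..y'}) = (x' - x) * (y' - y)"
    using True by (simp add: content_Pair)
  with True show ?thesis by (auto simp: box_iv_def)
qed (auto simp: box_iv_def)

lemma sum_iv_wt_times:
  "(\<Sum>z\<in>A \<times> B. iv_wt s k z) =
     (if k = 0 then sum chi_wt A * sum chi_wt B
      else if k = 1 then sum (len_wt s) A * sum chi_wt B + sum chi_wt A * sum (len_wt s) B
      else sum (len_wt s) A * sum (len_wt s) B)"
  unfolding iv_wt_def sum_product sum.cartesian_product
  by (simp add: sum.distrib case_prod_unfold)

text \<open>The nine pieces that make up a closed cell: its face, four edges and four vertices.
  Since sides are included, intersections of closed cells correspond to intersections of these
  sets.\<close>

definition halo :: "nat \<times> nat \<Rightarrow> (nat \<times> nat) set" where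
  "halo = (\<lambda>(a, b). cell_pts a \<times> cell_pts b)"

lemma INT_times:
  "(\<Inter>c\<in>I. X (fst c) \<times> Y (snd c)) = (\<Inter>a\<in>fst ` I. X a) \<times> (\<Inter>b\<in>snd ` I. Y b)"
proof (intro set_eqI iffI)
  fix z assume "z \<in> (\<Inter>a\<in>fst ` I. X a) \<times> (\<Inter>b\<in>snd ` I. Y b)"
  then show "z \<in> (\<Inter>c\<in>I. X (fst c) \<times> Y (snd c))" by (simp add: mem_Times_iff)
next
  fix z assume "z \<in> (\<Inter>c\<in>I. X (fst c) \<times> Y (snd c))"
  then show "z \<in> (\<Inter>a\<in>fst ` I. X a) \<times> (\<Inter>b\<in>snd ` I. Y b)" by (simp add: mem_Times_iff)
qed

lemma box_iv_INT_grid_cell: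
  assumes "finite I" "I \<noteq> {}" "M > 0"
  shows "box_iv k (\<Inter>(a, b)\<in>I. grid_cell M n a b) =
    (\<Sum>z\<in>(\<Inter>c\<in>I. halo c). iv_wt (1 / real M ^ n) k z)"
proof -
  define s where "s = 1 / real M ^ n"
  have s: "s > 0" using assms by (simp add: s_def)
  have cell: "grid_cell M n a b = {real a * s..(real a + 1) * s} \<times> {real b * s..(real b + 1) * s}" for a b
    by (simp add: grid_cell_def s_def cbox_Pair_eq)
  define A B where "A = fst ` I" and "B = snd ` I"
  have AB: "finite A" "A \<noteq> {}" "finite B" "B \<noteq> {}" using assms by (auto simp: A_def B_def)
  have *: "(\<Inter>(a, b)\<in>I. grid_cell M n a b) = {real (Max A) * s..(real (Min A) + 1) * s} \<times>
       {real (Max B) * s..(real (Min B) + 1) * s}"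
    using INT_times[of "\<lambda>a. {real a * s..(real a + 1) * s}" "\<lambda>a. {real a * s..(real a + 1) * s}" I]
      INT_interval[OF AB(1,2) s] INT_interval[OF AB(3,4) s]
    unfolding cell A_def[symmetric] B_def[symmetric] case_prod_unfold by simp
  have **: "(\<Inter>c\<in>I. halo c) = {2 * Max A..2 * Min A + 2} \<times> {2 * Max B..2 * Min B + 2}"
    using INT_times[of cell_pts cell_pts I] INT_cell_pts[OF AB(1,2)] INT_cell_pts[OF AB(3,4)]
    unfolding halo_def A_def[symmetric] B_def[symmetric] case_prod_unfold by simp
  have mm: "Min A \<le> Max A" "Min B \<le> Max B" using AB by auto
  show ?thesis
    unfolding * ** s_def[symmetric] sum_iv_wt_times box_iv_rectangle
      sum_wt_cell_pts[OF mm(1) s] sum_wt_cell_pts[OF mm(2) s]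
    by (simp split: if_splits)
qed

text \<open>\<open>union_iv\<close> ranges over sets of squares and takes signs from their
  cardinality; injectivity allows passing to sets of indices without changing either.\<close>

lemma grid_cell_inj:
  assumes "M > 0"
  shows "inj (\<lambda>(a, b). grid_cell M n a b)"
proof (rule injI, clarsimp)
  fix a b a' b'
  assume eq: "grid_cell M n a b = grid_cell M n a' b'"
  define N where "N = real M ^ n"
  have pos: "N > 0" using assms by (simp add: N_def)
  then have le: "real c / N \<le> (real c + 1) / N" for c by (simp add: divide_right_mono)
  have "{real a / N..(real a + 1) / N} \<times> {real b / N..(real b + 1) / N} =
      {real a' / N..(real a' + 1) / N} \<times> {real b' / N..(real b' + 1) / N}"
    using eq by (simp add: grid_cell_def cbox_Pair_eq N_def)
  moreover have "{real c / N..(real c + 1) / N} \<noteq> {}" for c using le[of c] by simp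
  ultimately have "{real a / N..(real a + 1) / N} = {real a' / N..(real a' + 1) / N}"
      "{real b / N..(real b + 1) / N} = {real b' / N..(real b' + 1) / N}"
    by (metis times_eq_iff)+
  then have "real a / N = real a' / N" "real b / N = real b' / N"
    using le by (metis Icc_eq_Icc)+
  with pos show "a = a' \<and> b = b'" by simp
qed

lemma union_iv_grid_cells:
  assumes "finite K" "M > 0"
  shows "union_iv k ((\<lambda>(a, b). grid_cell M n a b) ` K) =
    (\<Sum>z\<in>(\<Union>c\<in>K. halo c). iv_wt (1 / real M ^ n) k z)"
proof -
  define w where "w = iv_wt (1 / real M ^ n) k"
  define Z where "Z = (\<Union>c\<in>K. halo c)"
  \<comment> \<open>Restricting to the finite \<open>Z\<close> makes \<open>f\<close> additive on
    all disjoint sets, as \<open>Incl_Excl_UN\<close> requires; the default value 0 of infinite sums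
    would break this.\<close>
  define f where "f = (\<lambda>S. \<Sum>z\<in>S \<inter> Z. w z)"
  have finZ: "finite Z" using assms by (auto simp: Z_def halo_def cell_pts_def)
  have add: "f (S \<union> T) = f S + f T" if "disjnt S T" for S T
    unfolding f_def Int_Un_distrib2 using that finZ by (intro sum.union_disjoint) (auto simp: disjnt_def)
  let ?g = "\<lambda>(a, b). grid_cell M n a b"
  have inj: "inj ?g" by (rule grid_cell_inj[OF assms(2)])
  have "{\<I>. \<I> \<subseteq> G ` K \<and> \<I> \<noteq> {}} = image G ` {I. I \<subseteq> K \<and> I \<noteq> {}}"
    for G :: "nat \<times> nat \<Rightarrow> (real \<times> real) set"
    by (auto simp: subset_image_iff)
  note subsets = this[of ?g]
  have inj2: "inj_on (image ?g) {I. I \<subseteq> K \<and> I \<noteq> {}}"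
    using inj by (simp add: inj_on_def inj_image_eq_iff)
  have "union_iv k (?g ` K) =
      (\<Sum>I\<in>{I. I \<subseteq> K \<and> I \<noteq> {}}. (-1) ^ (card (?g ` I) + 1) * box_iv k (\<Inter>(?g ` I)))"
    unfolding union_iv_def subsets by (subst sum.reindex[OF inj2]) simp
  also have "\<dots> = (\<Sum>I\<in>{I. I \<subseteq> K \<and> I \<noteq> {}}. (-1) ^ (card I + 1) * f (\<Inter>(halo ` I)))"
  proof (rule sum.cong[OF refl])
    fix I assume I: "I \<in> {I. I \<subseteq> K \<and> I \<noteq> {}}"
    then have fin: "finite I" "I \<noteq> {}" using assms finite_subset by auto
    have "card (?g ` I) = card I" using inj by (simp add: card_image inj_on_subset)
    moreover have "(\<Inter>c\<in>I. halo c) \<inter> Z = (\<Inter>c\<in>I. halo c)" using I by (auto simp: Z_def)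
    ultimately show "(-1) ^ (card (?g ` I) + 1) * box_iv k (\<Inter>(?g ` I)) =
        (-1) ^ (card I + 1) * f (\<Inter>(halo ` I))"
      using box_iv_INT_grid_cell[OF fin assms(2), of k n] by (simp add: f_def w_def)
  qed
  also have "\<dots> = f (\<Union>(halo ` K))"
    using Incl_Excl_UN[of f K halo] add assms(1) by simp
  finally show ?thesis by (simp add: f_def w_def Z_def)
qed

section \<open>Covering probabilities\<close>

text \<open>\<open>s\<close> counts steps upwards from level \<open>n\<close>. The cell itself
  (\<open>s = 0\<close>) is included, the unit square (\<open>s = n\<close>) is not, since it is
  never discarded. The level tag keeps ancestors of different levels apart.\<close>

definition ancestors :: "nat \<Rightarrow> nat \<Rightarrow> nat \<times> nat \<Rightarrow> (nat \<times> nat \<times> nat) set" where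
  "ancestors M n = (\<lambda>(a, b). (\<lambda>s. (n - s, a div M ^ s, b div M ^ s)) ` {..<n})"

definition kept :: "nat \<Rightarrow> nat \<Rightarrow> (nat \<times> nat \<times> nat \<Rightarrow> bool) \<Rightarrow> nat \<times> nat \<Rightarrow> bool" where
  "kept M n \<omega> c \<longleftrightarrow> (\<forall>e\<in>ancestors M n c. \<omega> e)"

text \<open>The at most two columns of cells meeting the doubled coordinate \<open>i\<close>; they agree when \<open>i\<close> is odd
  or on the boundary of the unit square.\<close>

definition lo :: "nat \<Rightarrow> nat" where "lo i = (i - 1) div 2"
definition hi :: "nat \<Rightarrow> nat \<Rightarrow> nat" where "hi N i = min (i div 2) (N - 1)"

lemma lo_less: "i \<le> 2 * N \<Longrightarrow> N > 0 \<Longrightarrow> lo i < N"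
  by (simp add: lo_def less_mult_imp_div_less)

lemma hi_less: "N > 0 \<Longrightarrow> hi N i < N"
  by (simp add: hi_def min_less_iff_disj)

lemma mem_cell_pts_iff:
  assumes "i \<le> 2 * N" "a < N"
  shows "i \<in> cell_pts a \<longleftrightarrow> a = lo i \<or> a = hi N i"
proof (cases "even i")
  case True
  then obtain x where x: "i = 2 * x" by blast
  \<comment> \<open>At \<open>x = 0\<close> truncated subtraction, and at \<open>x = N\<close> the
    minimum, replace the missing column by the one that exists.\<close>
  have "lo i = x - 1" "hi N i = (if x < N then x else N - 1)"
    using x assms by (auto simp: lo_def hi_def)
  moreover have "i \<in> cell_pts a \<longleftrightarrow> a = x \<or> Suc a = x"
    unfolding x cell_pts_def atLeastAtMost_iff by presburger
  moreover have "x \<le> N" using x assms by simp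
  ultimately show ?thesis using assms(2) by (cases x; cases "x < N") auto
next
  case False
  then obtain x where x: "i = 2 * x + 1" by (blast elim: oddE)
  then have "x < N" using assms by simp
  then have "lo i = x" "hi N i = x" using x by (simp_all add: lo_def hi_def)
  moreover have "i \<in> cell_pts a \<longleftrightarrow> a = x"
    unfolding x cell_pts_def atLeastAtMost_iff by presburger
  ultimately show ?thesis by auto
qed

lemma kept_iff:
  "kept M n \<omega> (a, b) \<longleftrightarrow> (\<forall>j\<in>{1..n}. \<omega> (j, a div M ^ (n - j), b div M ^ (n - j)))"
proof
  assume k: "kept M n \<omega> (a, b)"
  show "\<forall>j\<in>{1..n}. \<omega> (j, a div M ^ (n - j), b div M ^ (n - j))"
  proof
    fix j assume "j \<in> {1..n}"
    then have "n - j \<in> {..<n}" "n - (n - j) = j" by auto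
    with k show "\<omega> (j, a div M ^ (n - j), b div M ^ (n - j))"
      unfolding kept_def ancestors_def by force
  qed
next
  assume "\<forall>j\<in>{1..n}. \<omega> (j, a div M ^ (n - j), b div M ^ (n - j))"
  then have "\<omega> (n - s, a div M ^ s, b div M ^ s)" if "s < n" for s
    using that by (force dest: bspec[of _ _ "n - s"])
  then show "kept M n \<omega> (a, b)"
    by (auto simp: kept_def ancestors_def)
qed

lemma perc_family_eq:
  "perc_family M n \<omega> =
    (\<lambda>(a, b). grid_cell M n a b) ` {c \<in> {..<M ^ n} \<times> {..<M ^ n}. kept M n \<omega> c}"
  unfolding perc_family_def kept_iff[symmetric] by (auto simp: image_iff)

definition covered :: "nat \<Rightarrow> nat \<Rightarrow> (nat \<times> nat \<times> nat \<Rightarrow> bool) \<Rightarrow> nat \<times> nat \<Rightarrow> bool" where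
  "covered M n \<omega> = (\<lambda>(i, j).
     kept M n \<omega> (lo i, lo j) \<or> kept M n \<omega> (lo i, hi (M ^ n) j) \<or>
     kept M n \<omega> (hi (M ^ n) i, lo j) \<or> kept M n \<omega> (hi (M ^ n) i, hi (M ^ n) j))"

text \<open>The index set no longer depends on \<open>\<omega>\<close>, so the expectation acts on
  the indicators alone.\<close>

lemma union_iv_perc_family:
  assumes "M > 0"
  shows "union_iv k (perc_family M n \<omega>) =
    (\<Sum>z\<in>{..2 * M ^ n} \<times> {..2 * M ^ n}. iv_wt (1 / real M ^ n) k z * of_bool (covered M n \<omega> z))"
proof -
  define N where "N = M ^ n"
  have N: "N > 0" using assms by (simp add: N_def)
  define K where "K = {c \<in> {..<N} \<times> {..<N}. kept M n \<omega> c}"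
  have bound: "halo c \<subseteq> {..2 * N} \<times> {..2 * N}" if "c \<in> K" for c
    using that by (auto simp: K_def halo_def cell_pts_def)
  have cov: "z \<in> (\<Union>c\<in>K. halo c) \<longleftrightarrow> covered M n \<omega> z" if z: "z \<in> {..2 * N} \<times> {..2 * N}" for z
  proof -
    obtain i j where ij: "z = (i, j)" "i \<le> 2 * N" "j \<le> 2 * N" using z by auto
    have "z \<in> (\<Union>c\<in>K. halo c) \<longleftrightarrow>
        (\<exists>a b. a < N \<and> b < N \<and> kept M n \<omega> (a, b) \<and> i \<in> cell_pts a \<and> j \<in> cell_pts b)"
      by (auto simp: K_def halo_def ij)
    also have "\<dots> \<longleftrightarrow> (\<exists>a b. a < N \<and> b < N \<and> kept M n \<omega> (a, b) \<and>
        (a = lo i \<or> a = hi N i) \<and> (b = lo j \<or> b = hi N j))"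
      using ij mem_cell_pts_iff by metis
    also have "\<dots> \<longleftrightarrow> covered M n \<omega> z"
      using lo_less[OF ij(2) N] lo_less[OF ij(3) N] hi_less[OF N]
      unfolding covered_def ij N_def[symmetric] by auto
    finally show ?thesis .
  qed
  have "union_iv k (perc_family M n \<omega>) = (\<Sum>z\<in>(\<Union>c\<in>K. halo c). iv_wt (1 / real M ^ n) k z)"
    unfolding perc_family_eq K_def N_def by (intro union_iv_grid_cells) (use assms in auto)
  also have "(\<Union>c\<in>K. halo c) = ({..2 * N} \<times> {..2 * N}) \<inter> (\<Union>c\<in>K. halo c)"
    using bound by blast
  also have "sum (iv_wt (1 / real M ^ n) k) \<dots> = (\<Sum>z\<in>{..2 * N} \<times> {..2 * N}.
      if z \<in> (\<Union>c\<in>K. halo c) then iv_wt (1 / real M ^ n) k z else 0)"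
    by (rule sum.inter_restrict) simp
  also have "\<dots> = (\<Sum>z\<in>{..2 * N} \<times> {..2 * N}. iv_wt (1 / real M ^ n) k z * of_bool (covered M n \<omega> z))"
    by (intro sum.cong refl) (simp only: cov, simp)
  finally show ?thesis by (simp add: N_def)
qed

section \<open>Independence and joint survival of cells\<close>

lemma finite_cells_upto [simp]: "finite (cells_upto M n)"
proof (rule finite_subset)
  show "cells_upto M n \<subseteq> (\<Union>j\<in>{1..n}. {j} \<times> {..<M ^ j} \<times> {..<M ^ j})"
    by (auto simp: cells_upto_def)
qed auto

lemma ancestors_subset:
  assumes "a < M ^ n" "b < M ^ n" "M > 0"
  shows "ancestors M n (a, b) \<subseteq> cells_upto M n"
proof -
  have "x div M ^ s < M ^ (n - s)" if "x < M ^ n" "s < n" for x s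
  proof -
    have "M ^ n = M ^ (n - s) * M ^ s" using that by (simp flip: power_add)
    with that show ?thesis using assms by (simp add: less_mult_imp_div_less)
  qed
  with assms show ?thesis by (auto simp: ancestors_def cells_upto_def)
qed

abbreviation perc_pmf :: "nat \<Rightarrow> real \<Rightarrow> nat \<Rightarrow> (nat \<times> nat \<times> nat \<Rightarrow> bool) pmf" where
  "perc_pmf M p n \<equiv> Pi_pmf (cells_upto M n) False (\<lambda>_. bernoulli_pmf p)"

lemma integrable_perc_pmf [simp]:
  fixes f :: "_ \<Rightarrow> real"
  shows "integrable (measure_pmf (perc_pmf M p n)) f"
proof (rule integrable_measure_pmf_finite)
  show "finite (set_pmf (perc_pmf M p n))"
    by (rule finite_subset[OF set_Pi_pmf_subset']) auto
qed

lemma expectation_all_kept: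
  assumes "S \<subseteq> cells_upto M n" "0 \<le> p" "p \<le> 1"
  shows "measure_pmf.expectation (perc_pmf M p n) (\<lambda>\<omega>. of_bool (\<forall>e\<in>S. \<omega> e)) = p ^ card S"
proof -
  let ?B = "\<lambda>e. if e \<in> S then {True} else UNIV"
  have "(\<lambda>\<omega>. of_bool (\<forall>e\<in>S. \<omega> e) :: real) = indicator (Pi (cells_upto M n) ?B)"
    using assms(1) by (fastforce simp: indicator_def fun_eq_iff Pi_iff split: if_splits)
  then have "measure_pmf.expectation (perc_pmf M p n) (\<lambda>\<omega>. of_bool (\<forall>e\<in>S. \<omega> e)) =
      measure_pmf.prob (perc_pmf M p n) (Pi (cells_upto M n) ?B)"
    by simp
  also have "\<dots> = (\<Prod>e\<in>cells_upto M n. measure_pmf.prob (bernoulli_pmf p) (?B e))"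
    by (rule measure_Pi_pmf_Pi) simp
  also have "\<dots> = (\<Prod>e\<in>cells_upto M n. if e \<in> S then p else 1)"
    using assms by (intro prod.cong) (auto simp: measure_pmf_single)
  also have "\<dots> = p ^ card S"
    using assms(1) by (simp add: prod.If_cases Int_absorb1)
  finally show ?thesis .
qed

text \<open>Ancestors on different levels are distinct, so they are counted level by level as
  distinct images of \<open>J\<close> under division by \<open>M ^ s\<close>.\<close>

lemma card_UN_ancestors:
  assumes "finite J"
  shows "card (\<Union>c\<in>J. ancestors M n c) = (\<Sum>s<n. card ((\<lambda>(a, b). (a div M ^ s, b div M ^ s)) ` J))"
proof -
  let ?h = "\<lambda>s (a, b). (a div M ^ s, b div M ^ s)"
  have "(\<Union>c\<in>J. ancestors M n c) = (\<lambda>(s, e). (n - s, e)) ` (SIGMA s:{..<n}. ?h s ` J)"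
    by (force simp: ancestors_def)
  moreover have "inj_on (\<lambda>(s, e). (n - s, e)) (SIGMA s:{..<n}. ?h s ` J)"
    by (auto simp: inj_on_def)
  ultimately have "card (\<Union>c\<in>J. ancestors M n c) = card (SIGMA s:{..<n}. ?h s ` J)"
    by (simp add: card_image)
  also have "\<dots> = (\<Sum>s<n. card (?h s ` J))"
    using assms by (intro card_SigmaI) auto
  finally show ?thesis .
qed

lemma expectation_kept:
  assumes "finite J" "J \<subseteq> {..<M ^ n} \<times> {..<M ^ n}" "M > 0" "0 \<le> p" "p \<le> 1"
  shows "measure_pmf.expectation (perc_pmf M p n) (\<lambda>\<omega>. of_bool (\<forall>c\<in>J. kept M n \<omega> c)) =
    p ^ (\<Sum>s<n. card ((\<lambda>(a, b). (a div M ^ s, b div M ^ s)) ` J))"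
proof -
  have sub: "(\<Union>c\<in>J. ancestors M n c) \<subseteq> cells_upto M n"
  proof (rule UN_least)
    fix c assume "c \<in> J"
    then have "fst c < M ^ n" "snd c < M ^ n" using assms(2) by auto
    from ancestors_subset[OF this assms(3)] show "ancestors M n c \<subseteq> cells_upto M n" by simp
  qed
  have all: "(\<forall>c\<in>J. kept M n \<omega> c) \<longleftrightarrow> (\<forall>e\<in>(\<Union>c\<in>J. ancestors M n c). \<omega> e)" for \<omega>
    by (simp add: kept_def)
  show ?thesis
    unfolding all expectation_all_kept[OF sub assms(4,5)] card_UN_ancestors[OF assms(1)] ..
qed

text \<open>The summands count distinct ancestors at height \<open>s\<close> for an adjacent pair, a
  diagonal pair, a triple and all four cells. The last one is the product of 1 or 2 columns with 1
  or 2 rows.\<close>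

lemma sum_level_cards:
  fixes A B n :: nat
  assumes "A \<le> n" "B \<le> n"
  shows "(\<Sum>s<n. 1 + of_bool (s < A)) = n + A"
    and "(\<Sum>s<n. 1 + of_bool (s < A \<or> s < B)) = n + max A B"
    and "(\<Sum>s<n. 1 + of_bool (s < A) + of_bool (s < B)) = n + A + B"
    and "(\<Sum>s<n. 1 + of_bool (s < A) + of_bool (s < B) + of_bool (s < A \<and> s < B)) = n + A + B + min A B"
proof -
  have *: "(\<Sum>s<n. of_bool (s < k)) = k" if "k \<le> n" for k
  proof -
    have "{..<n} \<inter> {s. s < k} = {..<k}" using that by auto
    then show ?thesis by simp
  qed
  have or_eq: "s < A \<or> s < B \<longleftrightarrow> s < max A B" and and_eq: "s < A \<and> s < B \<longleftrightarrow> s < min A B" for s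
    by auto
  show "(\<Sum>s<n. 1 + of_bool (s < A)) = n + A"
    and "(\<Sum>s<n. 1 + of_bool (s < A \<or> s < B)) = n + max A B"
    and "(\<Sum>s<n. 1 + of_bool (s < A) + of_bool (s < B)) = n + A + B"
    and "(\<Sum>s<n. 1 + of_bool (s < A) + of_bool (s < B) + of_bool (s < A \<and> s < B)) = n + A + B + min A B"
    unfolding or_eq and_eq sum.distrib *[OF assms(1)] *[OF assms(2)]
      *[OF max.boundedI[OF assms]] *[OF min.coboundedI1[OF assms(1)]] by simp_all
qed

text \<open>A set of cells is kept with probability \<open>p\<close> to the number of its distinct ancestors; \<open>A\<close> and
  \<open>B\<close> count the levels on which the two columns, respectively the two rows, around a point are
  distinct. The terms of \<open>phi\<close> are those of inclusion-exclusion over the four surrounding cells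
  (single, adjacent, diagonal pairs, triples, all four), divided by \<open>p ^ n\<close>. Coinciding rows or
  columns (\<open>A = 0\<close> or \<open>B = 0\<close>) need no separate treatment.\<close>

definition phi :: "real \<Rightarrow> nat \<Rightarrow> nat \<Rightarrow> real" where
  "phi p A B = 4 - 2 * p ^ A - 2 * p ^ B - 2 * p ^ max A B + 4 * p ^ (A + B) - p ^ (A + B + min A B)"

lemma of_bool_disj4:
  "(of_bool (P \<or> Q \<or> R \<or> S) :: real) =
    of_bool P + of_bool Q + of_bool R + of_bool S
    - of_bool (P \<and> Q) - of_bool (R \<and> S) - of_bool (P \<and> R) - of_bool (Q \<and> S)
    - of_bool (P \<and> S) - of_bool (Q \<and> R)
    + of_bool (P \<and> Q \<and> R) + of_bool (P \<and> Q \<and> S) + of_bool (P \<and> R \<and> S) + of_bool (Q \<and> R \<and> S)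
    - of_bool (P \<and> Q \<and> R \<and> S)"
  by (cases P; cases Q; cases R; cases S; simp)

lemma expectation_four_cells:
  assumes cells: "x < M ^ n" "x' < M ^ n" "y < M ^ n" "y' < M ^ n" and "M > 0" "0 \<le> p" "p \<le> 1"
    and "A \<le> n" "\<And>s. s < n \<Longrightarrow> x div M ^ s \<noteq> x' div M ^ s \<longleftrightarrow> s < A"
    and "B \<le> n" "\<And>s. s < n \<Longrightarrow> y div M ^ s \<noteq> y' div M ^ s \<longleftrightarrow> s < B"
  shows "measure_pmf.expectation (perc_pmf M p n)
      (\<lambda>\<omega>. of_bool (kept M n \<omega> (x, y) \<or> kept M n \<omega> (x, y') \<or> kept M n \<omega> (x', y) \<or> kept M n \<omega> (x', y'))) =
    p ^ n * phi p A B"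
proof -
  let ?E = "measure_pmf.expectation (perc_pmf M p n)"
  let ?k = "kept M n"
  have A: "x div M ^ s = x' div M ^ s \<longleftrightarrow> \<not> s < A" and B: "y div M ^ s = y' div M ^ s \<longleftrightarrow> \<not> s < B"
    if "s < n" for s using assms(9,11) that by auto
  have A': "x' div M ^ s = x div M ^ s \<longleftrightarrow> \<not> s < A" and B': "y' div M ^ s = y div M ^ s \<longleftrightarrow> \<not> s < B"
    if "s < n" for s using A[OF that] B[OF that] by (metis, metis)
  \<comment> \<open>Template for all fifteen terms: \<open>f s\<close> is the number of distinct
    ancestors of \<open>J\<close> at height \<open>s\<close>, and \<open>e\<close> is their
    total.\<close>
  have E: "?E (\<lambda>\<omega>. of_bool (Q \<omega>)) = p ^ e"
    if "(\<Sum>s<n. f s) = e" and "J \<subseteq> {x, x'} \<times> {y, y'}"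
      and "\<And>\<omega>. Q \<omega> \<longleftrightarrow> (\<forall>c\<in>J. ?k \<omega> c)"
      and "\<And>s. s < n \<Longrightarrow> card ((\<lambda>(a, b). (a div M ^ s, b div M ^ s)) ` J) = f s" for Q J e f
  proof -
    have "finite J" using that(2) finite_subset by blast
    moreover have "J \<subseteq> {..<M ^ n} \<times> {..<M ^ n}" using that(2) cells by auto
    ultimately show ?thesis using expectation_kept[of J M n p] assms(5-7) that by simp
  qed
  \<comment> \<open>The fifth entry is the first identity with \<open>B\<close> for
    \<open>A\<close>, used for pairs in one column.\<close>
  note sums = sum_level_cards[OF assms(8,10)] sum_level_cards(1)[OF assms(10) assms(10)]
  have one: "?E (\<lambda>\<omega>. of_bool (?k \<omega> c)) = p ^ n" if "c \<in> {x, x'} \<times> {y, y'}" for c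
    using that by (intro E[of "\<lambda>_. 1" n "{c}"]) auto
  have h: "?E (\<lambda>\<omega>. of_bool (?k \<omega> (x, b) \<and> ?k \<omega> (x', b))) = p ^ (n + A)" if "b \<in> {y, y'}" for b
    by (rule E[of _ _ "{(x, b), (x', b)}", OF sums(1)])
      (use that in \<open>auto simp: A A' B B' card_insert_if\<close>)
  have v: "?E (\<lambda>\<omega>. of_bool (?k \<omega> (a, y) \<and> ?k \<omega> (a, y'))) = p ^ (n + B)" if "a \<in> {x, x'}" for a
    by (rule E[of _ _ "{(a, y), (a, y')}", OF sums(5)])
      (use that in \<open>auto simp: A A' B B' card_insert_if\<close>)
  have d1: "?E (\<lambda>\<omega>. of_bool (?k \<omega> (x, y) \<and> ?k \<omega> (x', y'))) = p ^ (n + max A B)"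
    by (rule E[of _ _ "{(x, y), (x', y')}", OF sums(2)])
      (auto simp: A A' B B' card_insert_if)
  have d2: "?E (\<lambda>\<omega>. of_bool (?k \<omega> (x, y') \<and> ?k \<omega> (x', y))) = p ^ (n + max A B)"
    by (rule E[of _ _ "{(x, y'), (x', y)}", OF sums(2)])
      (auto simp: A A' B B' card_insert_if)
  have t1: "?E (\<lambda>\<omega>. of_bool (?k \<omega> (x, y) \<and> ?k \<omega> (x, y') \<and> ?k \<omega> (x', y))) = p ^ (n + A + B)"
    by (rule E[of _ _ "{(x, y), (x, y'), (x', y)}", OF sums(3)])
      (auto simp: A A' B B' card_insert_if)
  have t2: "?E (\<lambda>\<omega>. of_bool (?k \<omega> (x, y) \<and> ?k \<omega> (x, y') \<and> ?k \<omega> (x', y'))) = p ^ (n + A + B)"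
    by (rule E[of _ _ "{(x, y), (x, y'), (x', y')}", OF sums(3)])
      (auto simp: A A' B B' card_insert_if)
  have t3: "?E (\<lambda>\<omega>. of_bool (?k \<omega> (x, y) \<and> ?k \<omega> (x', y) \<and> ?k \<omega> (x', y'))) = p ^ (n + A + B)"
    by (rule E[of _ _ "{(x, y), (x', y), (x', y')}", OF sums(3)])
      (auto simp: A A' B B' card_insert_if)
  have t4: "?E (\<lambda>\<omega>. of_bool (?k \<omega> (x, y') \<and> ?k \<omega> (x', y) \<and> ?k \<omega> (x', y'))) = p ^ (n + A + B)"
    by (rule E[of _ _ "{(x, y'), (x', y), (x', y')}", OF sums(3)])
      (auto simp: A A' B B' card_insert_if)
  have q: "?E (\<lambda>\<omega>. of_bool (?k \<omega> (x, y) \<and> ?k \<omega> (x, y') \<and> ?k \<omega> (x', y) \<and> ?k \<omega> (x', y'))) =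
      p ^ (n + A + B + min A B)"
    by (rule E[of _ _ "{(x, y), (x, y'), (x', y), (x', y')}", OF sums(4)])
      (auto simp: A A' B B' card_insert_if)
  show ?thesis
    unfolding of_bool_disj4
    \<comment> \<open>\<open>of_bool_conj\<close> would turn the conjunctions into products, which
      the computed expectations no longer match.\<close>
    by (simp add: one h v d1 d2 t1 t2 t3 t4 q phi_def power_add algebra_simps del: of_bool_conj)
qed

section \<open>Levels separating neighbouring columns\<close>

definition sep :: "nat \<Rightarrow> nat \<Rightarrow> nat \<Rightarrow> nat" where
  "sep M n i = card {s \<in> {..<n}. lo i div M ^ s \<noteq> hi (M ^ n) i div M ^ s}"

lemma sep_le: "sep M n i \<le> n"
  using card_mono[of "{..<n}" "{s \<in> {..<n}. lo i div M ^ s \<noteq> hi (M ^ n) i div M ^ s}"]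
  by (auto simp: sep_def)

lemma less_card_down_closed:
  assumes "\<And>s t. s \<le> t \<Longrightarrow> R t \<Longrightarrow> R s" "s < n"
  shows "R s \<longleftrightarrow> s < card {s \<in> {..<n}. R s}"
proof -
  \<comment> \<open>The first failing index; it exists because \<open>n\<close> itself
    fails.\<close>
  define m where "m = (LEAST m. \<not> (m < n \<and> R m))"
  have m: "\<not> (m < n \<and> R m)" unfolding m_def by (rule LeastI[of _ n]) simp
  have less: "t < n \<and> R t" if "t < m" for t using not_less_Least[of t] that unfolding m_def by blast
  have "{s \<in> {..<n}. R s} = {..<m}"
  proof (intro set_eqI iffI)
    fix t assume t: "t \<in> {s \<in> {..<n}. R s}"
    show "t \<in> {..<m}"
    proof (rule ccontr)
      assume "t \<notin> {..<m}"
      then have "m \<le> t" by simp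
      with t have "m < n \<and> R m" using assms(1)[of m t] by auto
      with m show False by simp
    qed
  qed (use less in auto)
  then have "card {s \<in> {..<n}. R s} = m" "R s \<longleftrightarrow> s < m" using assms(2) by auto
  then show ?thesis by simp
qed

text \<open>Once two columns have a common ancestor column, they agree at all greater heights, so
  the separating heights form an initial segment.\<close>

lemma separated_iff:
  assumes "s < n"
  shows "lo i div M ^ s \<noteq> hi (M ^ n) i div M ^ s \<longleftrightarrow> s < sep M n i"
  unfolding sep_def
proof (rule less_card_down_closed[OF _ assms])
  fix s t :: nat
  assume st: "s \<le> t" and ne: "lo i div M ^ t \<noteq> hi (M ^ n) i div M ^ t"
  have "x div M ^ t = x div M ^ s div M ^ (t - s)" for x
    using st by (simp flip: div_mult2_eq power_add)
  with ne show "lo i div M ^ s \<noteq> hi (M ^ n) i div M ^ s" by metis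
qed

lemma expectation_covered:
  assumes "i \<le> 2 * M ^ n" "j \<le> 2 * M ^ n" "M > 0" "0 \<le> p" "p \<le> 1"
  shows "measure_pmf.expectation (perc_pmf M p n) (\<lambda>\<omega>. of_bool (covered M n \<omega> (i, j))) =
    p ^ n * phi p (sep M n i) (sep M n j)"
  unfolding covered_def prod.case
  using assms by (intro expectation_four_cells lo_less hi_less sep_le separated_iff) auto

lemma expected_iv_eq:
  assumes "M > 0" "0 \<le> p" "p \<le> 1"
  shows "expected_iv M p k n = p ^ n *
    (\<Sum>(i, j)\<in>{..2 * M ^ n} \<times> {..2 * M ^ n}.
       iv_wt (1 / real M ^ n) k (i, j) * phi p (sep M n i) (sep M n j))"
proof -
  have "expected_iv M p k n = (\<Sum>z\<in>{..2 * M ^ n} \<times> {..2 * M ^ n}.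
      iv_wt (1 / real M ^ n) k z *
      measure_pmf.expectation (perc_pmf M p n) (\<lambda>\<omega>. of_bool (covered M n \<omega> z)))"
    unfolding expected_iv_def union_iv_perc_family[OF assms(1)]
    by (simp del: sum_mult_of_bool_eq sum_of_bool_mult_eq)
  also have "\<dots> = (\<Sum>(i, j)\<in>{..2 * M ^ n} \<times> {..2 * M ^ n}.
      p ^ n * (iv_wt (1 / real M ^ n) k (i, j) * phi p (sep M n i) (sep M n j)))"
    using expectation_covered[OF _ _ assms] by (intro sum.cong) auto
  finally show ?thesis by (simp add: sum_distrib_left case_prod_unfold)
qed

section \<open>Sums over valuations and their limits\<close>

lemma sum_atMost_even_odd:
  fixes F :: "nat \<Rightarrow> real"
  shows "(\<Sum>i\<le>2 * N. F i) = (\<Sum>x\<le>N. F (2 * x)) + (\<Sum>x<N. F (2 * x + 1))"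
  by (induction N) simp_all

lemma sum_atMost_ends:
  fixes F :: "nat \<Rightarrow> real"
  assumes "N > 0"
  shows "(\<Sum>x\<le>N. F x) = F 0 + F N + (\<Sum>x\<in>{0<..<N}. F x)"
proof -
  have "{..N} = insert 0 (insert N {0<..<N})" using assms by auto
  then show ?thesis using assms by simp
qed

text \<open>Non-multiples of \<open>M\<close> have count 1, and there are \<open>(M - 1) M^n\<close>
  of them below \<open>M ^ Suc n\<close>. The multiples are \<open>M * y\<close> with
  \<open>0 < y < M ^ n\<close>, and their count is one more than that of \<open>y\<close>. The
  induction therefore varies \<open>G\<close>, since the hypothesis is applied to \<open>G\<close>
  shifted by \<open>Suc\<close>.\<close>

lemma sum_valuation:
  fixes G :: "nat \<Rightarrow> real"
  assumes "M \<ge> 2"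
  shows "(\<Sum>x\<in>{0<..<M ^ n}. G (card {s \<in> {..<n}. M ^ s dvd x})) =
    (\<Sum>k\<in>{1..n}. (real M - 1) * real M ^ (n - k) * G k)"
proof (induction n arbitrary: G)
  case 0
  have "{0<..<M ^ 0} = {}" by auto
  then show ?case by (simp only: sum.empty) simp
next
  case (Suc n)
  let ?c = "\<lambda>n x. card {s \<in> {..<n}. M ^ s dvd x}"
  define U V where "U = {x \<in> {0<..<M ^ Suc n}. M dvd x}" and "V = {x \<in> {0<..<M ^ Suc n}. \<not> M dvd x}"
  have UV: "{0<..<M ^ Suc n} = U \<union> V" "U \<inter> V = {}" "finite U" "finite V"
    by (auto simp: U_def V_def)
  have inj: "inj_on ((*) M) S" for S using assms by (auto simp: inj_on_def)
  have U: "U = (*) M ` {0<..<M ^ n}"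
  proof (intro set_eqI iffI)
    fix x assume "x \<in> U"
    then obtain y where "x = M * y" "0 < x" "x < M * M ^ n" by (auto simp: U_def elim: dvdE)
    then show "x \<in> (*) M ` {0<..<M ^ n}" by simp
  qed (use assms in \<open>auto simp: U_def\<close>)
  have "card U = M ^ n - 1" by (simp add: U card_image inj)
  moreover have "M ^ n \<ge> 1" "M ^ Suc n \<ge> 1" using assms by simp_all
  moreover have "card U + card V = M ^ Suc n - 1"
    using card_Un_disjoint[OF UV(3,4,2)] by (simp add: UV(1)[symmetric])
  ultimately have "card U + 1 = M ^ n" "card U + card V + 1 = M ^ Suc n" by simp_all
  then have "real (card U) + 1 = real M ^ n" "real (card U) + real (card V) + 1 = real M ^ Suc n"
    by (metis of_nat_1 of_nat_add of_nat_power)+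
  then have cardV: "real (card V) = (real M - 1) * real M ^ n" by (simp add: algebra_simps)
  have cV: "?c (Suc n) x = 1" if "x \<in> V" for x
  proof -
    have "s = 0" if "M ^ s dvd x" for s
      using that \<open>x \<in> V\<close> by (cases s) (auto simp: V_def dest: dvd_mult_left)
    then have "{s \<in> {..<Suc n}. M ^ s dvd x} = {0}" by auto
    then show ?thesis by simp
  qed
  have cU: "?c (Suc n) (M * y) = Suc (?c n y)" for y
  proof -
    have "{s \<in> {..<Suc n}. M ^ s dvd M * y} = insert 0 (Suc ` {s \<in> {..<n}. M ^ s dvd y})"
      using assms by (auto simp: image_iff less_Suc_eq_0_disj)
    then show ?thesis by (simp add: card_image)
  qed
  have "(\<Sum>x\<in>{0<..<M ^ Suc n}. G (?c (Suc n) x)) =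
      (\<Sum>x\<in>U. G (?c (Suc n) x)) + (\<Sum>x\<in>V. G (?c (Suc n) x))"
    unfolding UV(1) using UV by (intro sum.union_disjoint)
  also have "(\<Sum>x\<in>V. G (?c (Suc n) x)) = (real M - 1) * real M ^ n * G 1"
    using cV cardV by simp
  also have "(\<Sum>x\<in>U. G (?c (Suc n) x)) = (\<Sum>y\<in>{0<..<M ^ n}. G (Suc (?c n y)))"
    unfolding U by (simp only: sum.reindex[OF inj] o_def cU)
  also have "\<dots> = (\<Sum>k\<in>{1..n}. (real M - 1) * real M ^ (n - k) * G (Suc k))"
    by (rule Suc.IH)
  also have "\<dots> = (\<Sum>k\<in>{2..Suc n}. (real M - 1) * real M ^ (Suc n - k) * G k)"
    by (rule sum.reindex_bij_witness[of _ "\<lambda>k. k - 1" Suc]) auto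
  also have "\<dots> + (real M - 1) * real M ^ n * G 1 =
      (\<Sum>k\<in>{1..Suc n}. (real M - 1) * real M ^ (Suc n - k) * G k)"
  proof -
    have "{1..Suc n} = insert 1 {2..Suc n}" by auto
    then have split: "sum F {1..Suc n} = F 1 + sum F {2..Suc n}" for F :: "nat \<Rightarrow> real" by simp
    show ?thesis by (simp only: split) simp
  qed
  finally show ?case .
qed

lemma sep_odd: "x < M ^ n \<Longrightarrow> sep M n (2 * x + 1) = 0"
  by (simp add: sep_def lo_def hi_def)

lemma sep_ends: "M > 0 \<Longrightarrow> sep M n 0 = 0" "M > 0 \<Longrightarrow> sep M n (2 * M ^ n) = 0"
proof -
  have "(2 * N - 1) div 2 = N - 1" for N :: nat by (cases N) auto
  then show "M > 0 \<Longrightarrow> sep M n 0 = 0" "M > 0 \<Longrightarrow> sep M n (2 * M ^ n) = 0"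
    by (simp_all add: sep_def lo_def hi_def)
qed

text \<open>Passing from \<open>x - 1\<close> to \<open>x\<close> changes the quotient by
  \<open>m\<close> exactly when \<open>m\<close> divides \<open>x\<close>. So \<open>sep\<close> is
  one more than the \<open>M\<close>-adic valuation of \<open>x\<close>.\<close>

lemma sep_even:
  assumes "x \<in> {0<..<M ^ n}" "M > 0"
  shows "sep M n (2 * x) = card {s \<in> {..<n}. M ^ s dvd x}"
proof -
  obtain y where y: "x = Suc y" using assms by (cases x) auto
  have "lo (2 * x) = y" "hi (M ^ n) (2 * x) = Suc y" using assms by (simp_all add: lo_def hi_def y)
  moreover have "y div m \<noteq> Suc y div m \<longleftrightarrow> m dvd Suc y" for m
    by (simp add: div_Suc dvd_eq_mod_eq_0)
  ultimately show ?thesis by (simp add: sep_def y)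
qed

lemma phi_0: "phi p k 0 = 2 - p ^ k" "phi p 0 k = 2 - p ^ k"
  by (simp_all add: phi_def)

text \<open>The alternating sum over one axis, divided by \<open>m ^ n\<close>. Index 0 collects the
  two boundary vertices and, with sign -1, all \<open>m ^ n\<close> edges; index \<open>k\<close>
  collects the interior vertices of valuation \<open>k - 1\<close>.\<close>

definition chi_mean :: "real \<Rightarrow> nat \<Rightarrow> (nat \<Rightarrow> real) \<Rightarrow> real" where
  "chi_mean m n G = (2 / m ^ n - 1) * G 0 + (\<Sum>k\<in>{1..n}. (m - 1) * (1 / m) ^ k * G k)"

lemma sum_chi_wt_sep:
  fixes G :: "nat \<Rightarrow> real"
  assumes "M \<ge> 2"
  shows "(\<Sum>i\<le>2 * M ^ n. chi_wt i * G (sep M n i)) = real M ^ n * chi_mean (real M) n G"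
proof -
  have N: "M ^ n > 0" "M > 0" using assms by auto
  have "(\<Sum>i\<le>2 * M ^ n. chi_wt i * G (sep M n i)) =
      (\<Sum>x\<le>M ^ n. G (sep M n (2 * x))) - (\<Sum>x<M ^ n. G (sep M n (2 * x + 1)))"
    unfolding sum_atMost_even_odd by (simp add: chi_wt_def sum_negf)
  also have "(\<Sum>x<M ^ n. G (sep M n (2 * x + 1))) = real M ^ n * G 0"
    by (subst sum.cong[OF refl, of _ _ "\<lambda>_. G 0"]) (use sep_odd in auto)
  also have "(\<Sum>x\<le>M ^ n. G (sep M n (2 * x))) =
      2 * G 0 + (\<Sum>x\<in>{0<..<M ^ n}. G (sep M n (2 * x)))"
    unfolding sum_atMost_ends[OF N(1)] using sep_ends[OF N(2)] by simp
  also have "(\<Sum>x\<in>{0<..<M ^ n}. G (sep M n (2 * x))) =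
      (\<Sum>x\<in>{0<..<M ^ n}. G (card {s \<in> {..<n}. M ^ s dvd x}))"
    using sep_even N(2) by (intro sum.cong) auto
  also have "\<dots> = (\<Sum>k\<in>{1..n}. (real M - 1) * real M ^ (n - k) * G k)"
    by (rule sum_valuation[OF assms])
  also have "\<dots> = real M ^ n * (\<Sum>k\<in>{1..n}. (real M - 1) * (1 / real M) ^ k * G k)"
    unfolding sum_distrib_left using N
    by (intro sum.cong) (auto simp: power_diff power_divide)
  finally have "(\<Sum>i\<le>2 * M ^ n. chi_wt i * G (sep M n i)) =
      2 * G 0 + real M ^ n * (\<Sum>k\<in>{1..n}. (real M - 1) * (1 / real M) ^ k * G k) - real M ^ n * G 0" .
  moreover have "real M ^ n * (2 / real M ^ n - 1) = 2 - real M ^ n" using N by (simp add: right_diff_distrib)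
  ultimately show ?thesis
    by (simp only: chi_mean_def distrib_left mult.assoc[symmetric]) (simp add: left_diff_distrib)
qed

text \<open>Only edges have length; there are \<open>M ^ n\<close> of them, each of length
  \<open>1 / M ^ n\<close>, and none separates columns.\<close>

lemma sum_len_wt_sep:
  fixes G :: "nat \<Rightarrow> real"
  assumes "M > 0"
  shows "(\<Sum>i\<le>2 * M ^ n. len_wt (1 / real M ^ n) i * G (sep M n i)) = G 0"
proof -
  have "(\<Sum>i\<le>2 * M ^ n. len_wt (1 / real M ^ n) i * G (sep M n i)) =
      (\<Sum>x<M ^ n. (1 / real M ^ n) * G (sep M n (2 * x + 1)))"
    unfolding sum_atMost_even_odd by (simp add: len_wt_def)
  also have "\<dots> = (\<Sum>x<M ^ n. (1 / real M ^ n) * G 0)"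
    using sep_odd by (intro sum.cong) auto
  finally show ?thesis using assms by simp
qed

text \<open>Grouping pairs by their larger index makes \<open>max\<close> and \<open>min\<close>
  explicit, so that double sums reduce to geometric ones.\<close>

lemma sum_square_symmetric:
  fixes h :: "nat \<Rightarrow> nat \<Rightarrow> real"
  assumes "\<And>k l. h k l = h l k"
  shows "(\<Sum>k\<in>{1..n}. \<Sum>l\<in>{1..n}. h k l) = (\<Sum>m\<in>{1..n}. h m m + 2 * (\<Sum>k\<in>{1..<m}. h k m))"
proof (induction n)
  case (Suc n)
  have "(\<Sum>l\<in>{1..n}. h (Suc n) l) = (\<Sum>l\<in>{1..n}. h l (Suc n))"
    using assms by (intro sum.cong) auto
  moreover have "{1..<Suc n} = {1..n}" by auto
  ultimately show ?case using Suc by (simp add: sum.distrib)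
qed simp

lemma geometric_tendsto:
  fixes x :: real
  assumes "\<bar>x\<bar> < 1"
  shows "(\<lambda>n. \<Sum>k\<in>{1..n}. x ^ k) \<longlonglongrightarrow> x / (1 - x)"
proof -
  have "(\<Sum>k\<in>{1..n}. x ^ k) = x * (\<Sum>k<n. x ^ k)" for n
    by (induction n) (simp_all add: algebra_simps)
  moreover have "(\<lambda>n. x * (\<Sum>k<n. x ^ k)) \<longlonglongrightarrow> x * (1 / (1 - x))"
    using geometric_sums[of x] assms by (intro tendsto_mult_left) (simp add: sums_def)
  ultimately show ?thesis by simp
qed

lemma geometric_sum_less:
  fixes w :: real
  assumes "w \<noteq> 1" "m \<ge> 1"
  shows "(\<Sum>k\<in>{1..<m}. w ^ k) = (w - w ^ m) / (1 - w)"
  using assms(2)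
proof (induction m rule: dec_induct)
  case (step m)
  then have "(\<Sum>k\<in>{1..<Suc m}. w ^ k) = (w - w ^ m) / (1 - w) + w ^ m" by simp
  also have "\<dots> = (w - w ^ Suc m) / (1 - w)" using assms(1) by (simp add: divide_simps) (simp add: algebra_simps)
  finally show ?case .
qed simp

section \<open>Limits of single and double geometric sums\<close>

locale percolation_params =
  fixes m p :: real
  assumes m: "m \<ge> 2" and p: "0 < p" "p \<le> 1"
begin

abbreviation "q k \<equiv> (m - 1) * (1 / m) ^ (k::nat)"

lemma p_powers: "p ^ 2 \<le> 1" "p ^ 3 \<le> 1" "p < m" "p ^ 2 < m" "p < m ^ 2" "p ^ 3 < m ^ 2" "m < m ^ 2"
proof -
  show *: "p ^ 2 \<le> 1" "p ^ 3 \<le> 1" using p by (simp_all add: power_le_one)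
  show **: "m < m ^ 2" using m by (simp add: power2_eq_square)
  show "p < m" "p ^ 2 < m" "p < m ^ 2" "p ^ 3 < m ^ 2" using m p * ** by linarith+
qed

lemma pow_ratio_tendsto:
  fixes a b :: real
  assumes "0 \<le> a" "a < b"
  shows "(\<lambda>n. \<Sum>k\<in>{1..n}. (a / b) ^ k) \<longlonglongrightarrow> a / (b - a)"
proof -
  have "b > 0" using assms by linarith
  then have "1 - a / b = (b - a) / b" by (simp add: diff_divide_distrib)
  then have "a / b / (1 - a / b) = a / (b - a)" using assms by simp
  moreover have "(\<lambda>n. \<Sum>k\<in>{1..n}. (a / b) ^ k) \<longlonglongrightarrow> a / b / (1 - a / b)"
    by (rule geometric_tendsto) (use assms in auto)
  ultimately show ?thesis by (simp only:)
qed

lemma q_sum_tendsto: "(\<lambda>n. \<Sum>k\<in>{1..n}. q k) \<longlonglongrightarrow> 1"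
proof -
  have "(\<lambda>n. (m - 1) * (\<Sum>k\<in>{1..n}. (1 / m) ^ k)) \<longlonglongrightarrow> (m - 1) * (1 / (m - 1))"
    using m by (intro tendsto_mult_left pow_ratio_tendsto) auto
  then show ?thesis using m by (simp add: sum_distrib_left)
qed

lemma q_pow_sum_tendsto: "(\<lambda>n. \<Sum>k\<in>{1..n}. q k * p ^ k) \<longlonglongrightarrow> (m - 1) * (p / (m - p))"
proof -
  have "(\<lambda>n. (m - 1) * (\<Sum>k\<in>{1..n}. (p / m) ^ k)) \<longlonglongrightarrow> (m - 1) * (p / (m - p))"
    using p p_powers by (intro tendsto_mult_left pow_ratio_tendsto) auto
  then show ?thesis by (simp add: sum_distrib_left power_divide)
qed

lemma q_max_sum_tendsto:
  "(\<lambda>n. \<Sum>k\<in>{1..n}. \<Sum>l\<in>{1..n}. q k * q l * p ^ max k l)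
    \<longlonglongrightarrow> 2 * (m - 1) * (p / (m - p)) - (m ^ 2 - 1) * (p / (m ^ 2 - p))"
proof -
  have summand: "q j * q j * p ^ max j j + 2 * (\<Sum>k\<in>{1..<j}. q k * q j * p ^ max k j) =
      2 * (m - 1) * (p / m) ^ j - (m ^ 2 - 1) * (p / m ^ 2) ^ j" if "j \<ge> 1" for j
  proof -
    \<comment> \<open>Below \<open>j\<close> the weights \<open>q k\<close> add up to
      \<open>1 - m * (1 / m) ^ j\<close>. Twice this, together with the diagonal term, yields the
      coefficient \<open>- 2 m (m - 1) + (m - 1)^2 = - (m^2 - 1)\<close> of
      \<open>(p / m^2) ^ j\<close>.\<close>
    have "(\<Sum>k\<in>{1..<j}. q k * q j * p ^ max k j) = (\<Sum>k\<in>{1..<j}. (1 / m) ^ k * ((m - 1) * q j * p ^ j))"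
      by (intro sum.cong) (auto simp: max_def)
    also have "\<dots> = (1 / m - (1 / m) ^ j) / (1 - 1 / m) * ((m - 1) * q j * p ^ j)"
      unfolding sum_distrib_right[symmetric] using geometric_sum_less[of "1 / m" j] m that by simp
    also have "(1 / m - (1 / m) ^ j) / (1 - 1 / m) * ((m - 1) * q j * p ^ j) =
        (1 - m * (1 / m) ^ j) * q j * p ^ j"
      using m by (simp add: divide_simps)
    finally have *: "(\<Sum>k\<in>{1..<j}. q k * q j * p ^ max k j) = (1 - m * (1 / m) ^ j) * q j * p ^ j" .
    have "(p / m) ^ j = (1 / m) ^ j * p ^ j" "(p / m ^ 2) ^ j = (1 / m) ^ j * (1 / m) ^ j * p ^ j"
      by (simp_all add: power_divide power_mult_distrib power2_eq_square)
    then show ?thesis unfolding * by (simp add: algebra_simps power2_eq_square)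
  qed
  have eq: "(\<Sum>k\<in>{1..n}. \<Sum>l\<in>{1..n}. q k * q l * p ^ max k l) =
      2 * (m - 1) * (\<Sum>j\<in>{1..n}. (p / m) ^ j) - (m ^ 2 - 1) * (\<Sum>j\<in>{1..n}. (p / m ^ 2) ^ j)" for n
  proof -
    have "(\<Sum>k\<in>{1..n}. \<Sum>l\<in>{1..n}. q k * q l * p ^ max k l) =
      (\<Sum>j\<in>{1..n}. q j * q j * p ^ max j j + 2 * (\<Sum>k\<in>{1..<j}. q k * q j * p ^ max k j))"
      by (rule sum_square_symmetric) (simp add: ac_simps)
    also have "\<dots> = (\<Sum>j\<in>{1..n}. 2 * (m - 1) * (p / m) ^ j - (m ^ 2 - 1) * (p / m ^ 2) ^ j)"
      by (rule sum.cong[OF refl], rule summand) simp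
    finally show ?thesis by (simp only: sum_distrib_left sum_subtractf)
  qed
  show ?thesis
    unfolding eq using p p_powers by (intro tendsto_intros pow_ratio_tendsto) auto
qed

lemma q_min_sum_tendsto:
  "(\<lambda>n. \<Sum>k\<in>{1..n}. \<Sum>l\<in>{1..n}. q k * q l * p ^ (k + l + min k l))
    \<longlonglongrightarrow> (m - 1) ^ 2 * (2 * p ^ 2 / (m - p ^ 2) * (p / (m - p))
          - (m + p ^ 2) / (m - p ^ 2) * (p ^ 3 / (m ^ 2 - p ^ 3)))"
proof -
  \<comment> \<open>For \<open>k < j\<close> the exponent is \<open>2 k + j\<close>, so the
    dependence on \<open>k\<close> is geometric with ratio \<open>p^2 / m\<close>.\<close>
  define w where "w = p ^ 2 / m"
  have w: "w < 1" "1 - w > 0" using p_powers m by (auto simp: w_def)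
  have summand: "q j * q j * p ^ (j + j + min j j) + 2 * (\<Sum>k\<in>{1..<j}. q k * q j * p ^ (k + j + min k j)) =
      (m - 1) ^ 2 * (2 * (w / (1 - w)) * (p / m) ^ j + (1 - 2 / (1 - w)) * (p ^ 3 / m ^ 2) ^ j)"
    if "j \<ge> 1" for j
  proof -
    have "(\<Sum>k\<in>{1..<j}. q k * q j * p ^ (k + j + min k j)) =
        (\<Sum>k\<in>{1..<j}. w ^ k * ((m - 1) ^ 2 * (p / m) ^ j))"
      by (intro sum.cong)
        (auto simp: w_def power_divide power_add power2_eq_square power_mult_distrib)
    also have "\<dots> = (w - w ^ j) / (1 - w) * ((m - 1) ^ 2 * (p / m) ^ j)"
      unfolding sum_distrib_right[symmetric] using geometric_sum_less[of w j] w that by simp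
    finally have *: "(\<Sum>k\<in>{1..<j}. q k * q j * p ^ (k + j + min k j)) =
        (w - w ^ j) / (1 - w) * ((m - 1) ^ 2 * (p / m) ^ j)" .
    have "w ^ j * (p / m) ^ j = (p ^ 3 / m ^ 2) ^ j"
      by (simp add: w_def power2_eq_square power3_eq_cube flip: power_mult_distrib)
    moreover have "q j * q j * p ^ (j + j + min j j) = (m - 1) ^ 2 * (p ^ 3 / m ^ 2) ^ j"
      by (simp add: power_add power2_eq_square power3_eq_cube power_mult_distrib power_divide)
    ultimately show ?thesis unfolding *
      by (simp add: algebra_simps diff_divide_distrib)
  qed
  have eq: "(\<Sum>k\<in>{1..n}. \<Sum>l\<in>{1..n}. q k * q l * p ^ (k + l + min k l)) =
      (m - 1) ^ 2 * (2 * (w / (1 - w)) * (\<Sum>j\<in>{1..n}. (p / m) ^ j)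
        + (1 - 2 / (1 - w)) * (\<Sum>j\<in>{1..n}. (p ^ 3 / m ^ 2) ^ j))" for n
  proof -
    have "(\<Sum>k\<in>{1..n}. \<Sum>l\<in>{1..n}. q k * q l * p ^ (k + l + min k l)) =
      (\<Sum>j\<in>{1..n}. q j * q j * p ^ (j + j + min j j) + 2 * (\<Sum>k\<in>{1..<j}. q k * q j * p ^ (k + j + min k j)))"
      by (rule sum_square_symmetric) (simp add: ac_simps)
    also have "\<dots> = (\<Sum>j\<in>{1..n}. (m - 1) ^ 2 * (2 * (w / (1 - w)) * (p / m) ^ j + (1 - 2 / (1 - w)) * (p ^ 3 / m ^ 2) ^ j))"
      by (rule sum.cong[OF refl], rule summand) simp
    also have "\<dots> = (m - 1) ^ 2 * (2 * (w / (1 - w)) * (\<Sum>j\<in>{1..n}. (p / m) ^ j)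
        + (1 - 2 / (1 - w)) * (\<Sum>j\<in>{1..n}. (p ^ 3 / m ^ 2) ^ j))"
      by (simp only: sum_distrib_left[symmetric] sum.distrib)
    finally show ?thesis .
  qed
  have ww: "w / (1 - w) = p ^ 2 / (m - p ^ 2)" "1 - 2 / (1 - w) = - ((m + p ^ 2) / (m - p ^ 2))"
    using p_powers m by (simp_all add: w_def field_simps)
  have "(\<lambda>n. \<Sum>k\<in>{1..n}. \<Sum>l\<in>{1..n}. q k * q l * p ^ (k + l + min k l)) \<longlonglongrightarrow>
      (m - 1) ^ 2 * (2 * (w / (1 - w)) * (p / (m - p)) + (1 - 2 / (1 - w)) * (p ^ 3 / (m ^ 2 - p ^ 3)))"
    unfolding eq using p p_powers by (intro tendsto_intros pow_ratio_tendsto) auto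
  then show ?thesis unfolding ww by simp
qed

lemma two_div_tendsto: "(\<lambda>n. 2 / m ^ n - 1) \<longlonglongrightarrow> -1"
proof -
  have "(\<lambda>n. 2 * (1 / m) ^ n - 1) \<longlonglongrightarrow> 2 * 0 - 1"
    using m by (intro tendsto_intros LIMSEQ_power_zero) auto
  then show ?thesis by (simp add: power_divide)
qed

lemma q_edge_sum:
  "(\<Sum>k\<in>{1..n}. q k * (2 - p ^ k)) = 2 * (\<Sum>k\<in>{1..n}. q k) - (\<Sum>k\<in>{1..n}. q k * p ^ k)"
  unfolding right_diff_distrib sum_subtractf sum_distrib_right[symmetric] by (simp only: mult.commute[of _ 2])

text \<open>An edge has separation 0 across its own direction, so \<open>2 - p ^ k\<close> is the
  covering probability of two adjacent cells, divided by \<open>p ^ n\<close>.\<close>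

lemma chi_mean_edges_tendsto: "(\<lambda>n. chi_mean m n (\<lambda>k. 2 - p ^ k)) \<longlonglongrightarrow> 1 - (m - 1) * (p / (m - p))"
proof -
  have "chi_mean m n (\<lambda>k. 2 - p ^ k) =
      (2 / m ^ n - 1) + (2 * (\<Sum>k\<in>{1..n}. q k) - (\<Sum>k\<in>{1..n}. q k * p ^ k))" for n
    unfolding chi_mean_def q_edge_sum by simp
  moreover have "(\<lambda>n. (2 / m ^ n - 1) + (2 * (\<Sum>k\<in>{1..n}. q k) - (\<Sum>k\<in>{1..n}. q k * p ^ k)))
      \<longlonglongrightarrow> -1 + (2 * 1 - (m - 1) * (p / (m - p)))"
    by (intro tendsto_intros two_div_tendsto q_sum_tendsto q_pow_sum_tendsto)
  ultimately show ?thesis by simp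
qed

lemma chi_mean_vertices_tendsto:
  "(\<lambda>n. chi_mean m n (\<lambda>k. chi_mean m n (phi p k))) \<longlonglongrightarrow>
    1 - 2 * ((m - 1) * (p / (m - p))) + 4 * ((m - 1) * (p / (m - p))) ^ 2
    - 2 * (2 * (m - 1) * (p / (m - p)) - (m ^ 2 - 1) * (p / (m ^ 2 - p)))
    - (m - 1) ^ 2 * (2 * p ^ 2 / (m - p ^ 2) * (p / (m - p))
          - (m + p ^ 2) / (m - p ^ 2) * (p ^ 3 / (m ^ 2 - p ^ 3)))"
    (is "_ \<longlonglongrightarrow> 1 - 2 * ?g + 4 * ?g ^ 2 - 2 * ?X - ?Y")
proof -
  define e where "e n = 2 / m ^ n - 1" for n
  define Q where "Q n = (\<Sum>k\<in>{1..n}. q k)" for n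
  define P where "P n = (\<Sum>k\<in>{1..n}. q k * p ^ k)" for n
  define X where "X n = (\<Sum>k\<in>{1..n}. \<Sum>l\<in>{1..n}. q k * q l * p ^ max k l)" for n
  define Y where "Y n = (\<Sum>k\<in>{1..n}. \<Sum>l\<in>{1..n}. q k * q l * p ^ (k + l + min k l))" for n
  have edge: "(\<Sum>k\<in>{1..n}. q k * (2 - p ^ k)) = 2 * Q n - P n" for n
    unfolding Q_def P_def by (rule q_edge_sum)
  have double: "(\<Sum>k\<in>{1..n}. \<Sum>l\<in>{1..n}. q k * q l * phi p k l) =
      4 * Q n * Q n - 4 * P n * Q n - 2 * X n + 4 * P n * P n - Y n" for n
  proof -
    have QQ: "Q n * Q n = (\<Sum>k\<in>{1..n}. \<Sum>l\<in>{1..n}. q k * q l)"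
      and PQ: "P n * Q n = (\<Sum>k\<in>{1..n}. \<Sum>l\<in>{1..n}. q k * p ^ k * q l)"
      and QP: "Q n * P n = (\<Sum>k\<in>{1..n}. \<Sum>l\<in>{1..n}. q k * (q l * p ^ l))"
      and PP: "P n * P n = (\<Sum>k\<in>{1..n}. \<Sum>l\<in>{1..n}. q k * p ^ k * (q l * p ^ l))"
      unfolding Q_def P_def sum_product by (rule refl)+
    have "q k * q l * phi p k l = 4 * (q k * q l) - 2 * (q k * p ^ k * q l) - 2 * (q k * (q l * p ^ l))
        - 2 * (q k * q l * p ^ max k l) + 4 * (q k * p ^ k * (q l * p ^ l))
        - q k * q l * p ^ (k + l + min k l)" for k l
    proof -
      have "u * v * (4 - 2 * a - 2 * b - 2 * c + 4 * (a * b) - d) =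
          4 * (u * v) - 2 * (u * a * v) - 2 * (u * (v * b)) - 2 * (u * v * c)
          + 4 * (u * a * (v * b)) - u * v * d" for u v a b c d :: real
        by (simp add: algebra_simps)
      \<comment> \<open>The instance splits only \<open>p ^ (k + l)\<close>; the exponent
        \<open>k + l + min k l\<close> has to stay whole to match \<open>Y n\<close>.\<close>
      then show ?thesis unfolding phi_def power_add[of p k l] by blast
    qed
    then have "(\<Sum>k\<in>{1..n}. \<Sum>l\<in>{1..n}. q k * q l * phi p k l) =
        4 * (Q n * Q n) - 2 * (P n * Q n) - 2 * (Q n * P n) - 2 * X n + 4 * (P n * P n) - Y n"
      unfolding QQ PQ QP PP X_def Y_def by (simp only: sum.distrib sum_subtractf sum_distrib_left)
    then show ?thesis by (simp add: mult.commute)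
  qed
  have "chi_mean m n (\<lambda>k. chi_mean m n (phi p k)) =
      e n * (e n + (2 * Q n - P n)) + (e n * (2 * Q n - P n)
        + (4 * Q n * Q n - 4 * P n * Q n - 2 * X n + 4 * P n * P n - Y n))" for n
  proof -
    have "chi_mean m n (\<lambda>k. chi_mean m n (phi p k)) = e n * (e n * phi p 0 0 + (\<Sum>l\<in>{1..n}. q l * phi p 0 l))
        + (\<Sum>k\<in>{1..n}. q k * (e n * phi p k 0 + (\<Sum>l\<in>{1..n}. q l * phi p k l)))"
      by (simp add: chi_mean_def e_def)
    also have "(\<Sum>k\<in>{1..n}. q k * (e n * phi p k 0 + (\<Sum>l\<in>{1..n}. q l * phi p k l))) =
        e n * (\<Sum>k\<in>{1..n}. q k * phi p k 0) + (\<Sum>k\<in>{1..n}. \<Sum>l\<in>{1..n}. q k * q l * phi p k l)"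
      by (simp add: distrib_left sum.distrib sum_distrib_left mult.assoc mult.left_commute)
    finally show ?thesis unfolding double by (simp only: phi_0 edge) simp
  qed
  moreover have "(\<lambda>n. e n * (e n + (2 * Q n - P n)) + (e n * (2 * Q n - P n)
        + (4 * Q n * Q n - 4 * P n * Q n - 2 * X n + 4 * P n * P n - Y n)))
      \<longlonglongrightarrow> -1 * (-1 + (2 * 1 - ?g)) + (-1 * (2 * 1 - ?g)
        + (4 * 1 * 1 - 4 * ?g * 1 - 2 * ?X + 4 * ?g * ?g - ?Y))"
    unfolding e_def Q_def P_def X_def Y_def
    by (intro tendsto_intros two_div_tendsto q_sum_tendsto q_pow_sum_tendsto
        q_max_sum_tendsto q_min_sum_tendsto)
  moreover have "-1 * (-1 + (2 * 1 - g)) + (-1 * (2 * 1 - g)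
        + (4 * 1 * 1 - 4 * g * 1 - 2 * x + 4 * g * g - y)) = 1 - 2 * g + 4 * g ^ 2 - 2 * x - y"
    for g x y :: real by (simp add: power2_eq_square)
  ultimately show ?thesis by (simp only:)
qed

end

section \<open>Closed forms and normalisation\<close>

lemma expected_iv_closed_forms:
  fixes p :: real
  assumes "M \<ge> 2" "0 < p" "p \<le> 1"
  shows "expected_iv M p 2 n = p ^ n"
    and "expected_iv M p 1 n =
      p ^ n * real M ^ n * (2 * chi_mean (real M) n (\<lambda>k. 2 - p ^ k))"
    and "expected_iv M p 0 n =
      p ^ n * (real M ^ n * real M ^ n) *
      chi_mean (real M) n (\<lambda>k. chi_mean (real M) n (phi p k))"
proof -
  define s where "s = 1 / real M ^ n"
  let ?I = "{..2 * M ^ n}"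
  have chi: "(\<Sum>i\<in>?I. chi_wt i * G (sep M n i)) = real M ^ n * chi_mean (real M) n G" for G
    using sum_chi_wt_sep[OF assms(1), where n = n and G = G] .
  have len: "(\<Sum>i\<in>?I. len_wt s i * G (sep M n i)) = G 0" for G
    using sum_len_wt_sep[of M, where n = n and G = G] assms by (simp add: s_def)
  have E: "expected_iv M p k n = p ^ n *
      (\<Sum>i\<in>?I. \<Sum>j\<in>?I. iv_wt s k (i, j) * phi p (sep M n i) (sep M n j))" for k
    using expected_iv_eq[of M p k n] assms by (simp add: sum.cartesian_product s_def)
  have prod: "(\<Sum>i\<in>?I. \<Sum>j\<in>?I. u i * v j * phi p (sep M n i) (sep M n j)) =
      (\<Sum>i\<in>?I. u i * (\<Sum>j\<in>?I. v j * phi p (sep M n i) (sep M n j)))" for u v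
    by (simp add: sum_distrib_left mult.assoc)
  show "expected_iv M p 2 n = p ^ n"
    unfolding E iv_wt_def using len[of "\<lambda>a. phi p a 0"] by (simp add: prod len phi_0)
  have "(\<Sum>i\<in>?I. \<Sum>j\<in>?I. iv_wt s 1 (i, j) * phi p (sep M n i) (sep M n j)) =
      (\<Sum>i\<in>?I. len_wt s i * (\<Sum>j\<in>?I. chi_wt j * phi p (sep M n i) (sep M n j))) +
      (\<Sum>i\<in>?I. chi_wt i * (\<Sum>j\<in>?I. len_wt s j * phi p (sep M n i) (sep M n j)))"
    unfolding iv_wt_def prod[symmetric] by (simp add: sum.distrib distrib_right)
  also have "\<dots> = real M ^ n * (2 * chi_mean (real M) n (\<lambda>k. 2 - p ^ k))"
  proof -
    have "phi p 0 = (\<lambda>k. 2 - p ^ k)" by (simp add: fun_eq_iff phi_0)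
    then show ?thesis
      using len[of "\<lambda>a. real M ^ n * chi_mean (real M) n (phi p a)"] chi[of "\<lambda>k. 2 - p ^ k"]
      by (simp only: chi len phi_0)
  qed
  finally show "expected_iv M p 1 n = p ^ n * real M ^ n * (2 * chi_mean (real M) n (\<lambda>k. 2 - p ^ k))"
    unfolding E by (simp only: mult.assoc)
  have "(\<Sum>i\<in>?I. \<Sum>j\<in>?I. iv_wt s 0 (i, j) * phi p (sep M n i) (sep M n j)) =
      (\<Sum>i\<in>?I. chi_wt i * (real M ^ n * chi_mean (real M) n (phi p (sep M n i))))"
    unfolding iv_wt_def by (simp add: prod chi)
  also have "\<dots> = real M ^ n * (\<Sum>i\<in>?I. chi_wt i * chi_mean (real M) n (phi p (sep M n i)))"
    by (simp add: sum_distrib_left mult.left_commute)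
  also have "\<dots> = real M ^ n * real M ^ n * chi_mean (real M) n (\<lambda>k. chi_mean (real M) n (phi p k))"
    using chi[of "\<lambda>a. chi_mean (real M) n (phi p a)"] by simp
  finally show "expected_iv M p 0 n =
      p ^ n * (real M ^ n * real M ^ n) * chi_mean (real M) n (\<lambda>k. chi_mean (real M) n (phi p k))"
    unfolding E by (simp only: mult.assoc)
qed

text \<open>By the choice of \<open>D\<close>, \<open>m powr D = m ^ 2 * p\<close>.\<close>

lemma powr_similarity_dimension:
  fixes m p :: real
  assumes "m > 1" "p > 0"
  shows "(1 / m) powr (real n * (ln (m ^ 2 * p) / ln m - real c)) = (m ^ n) ^ c / (m ^ n * m ^ n * p ^ n)"
proof -
  have "(1 / m) powr (real n * (ln (m ^ 2 * p) / ln m - real c)) =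
      exp (real (n * c) * ln m - real n * ln (m ^ 2 * p))"
    using assms by (simp add: powr_def ln_div field_simps)
  also have "\<dots> = m ^ (n * c) / (m ^ 2 * p) ^ n"
    using assms exp_of_nat_mult[of "n * c" "ln m"] exp_of_nat_mult[of n "ln (m ^ 2 * p)"]
    unfolding exp_diff by simp
  also have "(m ^ 2 * p) ^ n = m ^ n * m ^ n * p ^ n"
    by (simp add: power_mult_distrib power2_eq_square)
  finally show ?thesis by (simp add: power_mult)
qed

theorem theorem1p2:
  fixes M :: nat and p :: real
  assumes "M \<ge> 2" and "1 / real M ^ 2 < p" and "p \<le> 1"
  defines "D \<equiv> ln (real M ^ 2 * p) / ln (real M)"
  defines "r \<equiv> 1 / real M"
  shows "((\<lambda>n. r powr (real n * (D - 2)) * expected_iv M p 2 n) \<longlonglongrightarrow> 1)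
    \<and> ((\<lambda>n. r powr (real n * (D - 1)) * expected_iv M p 1 n)
           \<longlonglongrightarrow> 2 * real M * (1 - p) / (real M - p))
    \<and> ((\<lambda>n. r powr (real n * (D - 0)) * expected_iv M p 0 n)
           \<longlonglongrightarrow> 1 - 2 * p * (real M - 1)^2 / (real M - p)
                  * (3 / (real M - 1) - 4 * p / (real M - p) + p^2 / (real M - p^2))
               + 2 * p * (real M ^ 2 - 1) / (real M ^ 2 - p)
               - 4 * p^2 * (real M - 1)^2 / (real M - p)^2
               + p^3 * (real M - 1)^2 * (real M + p^2) / ((real M - p^2) * (real M ^ 2 - p^3)))"
proof -
  define m where "m = real M"
  have m2: "m \<ge> 2" using assms(1) by (simp add: m_def)
  have p0: "p > 0" using assms(2) by (rule le_less_trans[rotated]) simp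
  interpret percolation_params m p by unfold_locales (use m2 p0 assms(3) in auto)
  note closed = expected_iv_closed_forms[OF assms(1) p0 assms(3), folded m_def]
  have scale: "r powr (real n * (D - real c)) = (m ^ n) ^ c / (m ^ n * m ^ n * p ^ n)" for n c
    using powr_similarity_dimension[of m p n c] m2 p0 by (simp add: r_def D_def m_def)
  have pos: "m ^ n \<noteq> 0" "p ^ n \<noteq> 0" for n using m2 p0 by auto
  have cancel: "a ^ 2 / (a * a * b) * b = 1" "a ^ 1 / (a * a * b) * (b * a * x) = x"
    "a ^ 0 / (a * a * b) * (b * (a * a) * x) = x" if "a \<noteq> 0" "b \<noteq> 0" for a b x :: real
    using that by (simp_all add: power2_eq_square)
  have scaled2: "r powr (real n * (D - 2)) * expected_iv M p 2 n = 1" for n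
    using scale[of n 2] unfolding closed of_nat_numeral by (simp only: cancel(1)[OF pos[of n]])
  have lim2: "(\<lambda>n. r powr (real n * (D - 2)) * expected_iv M p 2 n) \<longlonglongrightarrow> 1"
    unfolding scaled2 by (rule tendsto_const)
  have lim1: "(\<lambda>n. r powr (real n * (D - 1)) * expected_iv M p 1 n)
      \<longlonglongrightarrow> 2 * m * (1 - p) / (m - p)"
  proof -
    have "r powr (real n * (D - 1)) * expected_iv M p 1 n = 2 * chi_mean m n (\<lambda>k. 2 - p ^ k)" for n
      using scale[of n 1] unfolding closed of_nat_1 by (simp only: cancel(2)[OF pos[of n]])
    moreover have "(\<lambda>n. 2 * chi_mean m n (\<lambda>k. 2 - p ^ k)) \<longlonglongrightarrow> 2 * (1 - (m - 1) * (p / (m - p)))"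
      by (intro tendsto_mult_left chi_mean_edges_tendsto)
    moreover have "2 * (1 - (m - 1) * (p / (m - p))) = 2 * m * (1 - p) / (m - p)"
      using p_powers by (simp add: divide_simps) (simp add: algebra_simps)
    ultimately show ?thesis by simp
  qed
  have lim0: "(\<lambda>n. r powr (real n * (D - 0)) * expected_iv M p 0 n)
      \<longlonglongrightarrow> 1 - 2 * p * (m - 1)^2 / (m - p)
                  * (3 / (m - 1) - 4 * p / (m - p) + p^2 / (m - p^2))
               + 2 * p * (m ^ 2 - 1) / (m ^ 2 - p)
               - 4 * p^2 * (m - 1)^2 / (m - p)^2
               + p^3 * (m - 1)^2 * (m + p^2) / ((m - p^2) * (m ^ 2 - p^3))"
    (is "_ \<longlonglongrightarrow> ?L")
  proof -
    have "r powr (real n * (D - 0)) * expected_iv M p 0 n = chi_mean m n (\<lambda>k. chi_mean m n (phi p k))" for n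
      using scale[of n 0] unfolding closed of_nat_0 by (simp only: cancel(3)[OF pos[of n]])
    moreover have "1 - 2 * ((m - 1) * (p / (m - p))) + 4 * ((m - 1) * (p / (m - p))) ^ 2
        - 2 * (2 * (m - 1) * (p / (m - p)) - (m ^ 2 - 1) * (p / (m ^ 2 - p)))
        - (m - 1) ^ 2 * (2 * p ^ 2 / (m - p ^ 2) * (p / (m - p))
          - (m + p ^ 2) / (m - p ^ 2) * (p ^ 3 / (m ^ 2 - p ^ 3))) = ?L"
    proof -
      \<comment> \<open>With the reciprocals as atoms, the claim is a polynomial identity apart from
        \<open>3 / (m - 1)\<close>, which \<open>three\<close> clears. The 3 stems from
        \<open>2 + 4 = 6\<close> copies of \<open>(m - 1) p / (m - p)\<close>, four of them from the
        sum with \<open>max\<close>.\<close>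
      define u v w z where "u = 1 / (m - p)" and "v = 1 / (m - p ^ 2)"
        and "w = 1 / (m ^ 2 - p)" and "z = 1 / (m ^ 2 - p ^ 3)"
      have L: "?L = 1 - 2 * p * (m - 1)^2 * u * (3 / (m - 1) - 4 * p * u + p^2 * v)
          + 2 * p * (m ^ 2 - 1) * w - 4 * p^2 * (m - 1)^2 * u^2
          + p^3 * (m - 1)^2 * (m + p^2) * (v * z)"
        by (simp add: u_def v_def w_def z_def power_divide)
      have three: "(m - 1)^2 * (3 / (m - 1)) = 3 * (m - 1)" using m by (simp add: power2_eq_square)
      have "2 * p * (m - 1)^2 * u * (3 / (m - 1) - 4 * p * u + p^2 * v) =
          2 * p * u * ((m - 1)^2 * (3 / (m - 1))) + 2 * p * (m - 1)^2 * u * (- 4 * p * u + p^2 * v)"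
        by (simp add: algebra_simps)
      then have L': "?L = 1 - (2 * p * u * (3 * (m - 1)) + 2 * p * (m - 1)^2 * u * (- 4 * p * u + p^2 * v))
          + 2 * p * (m ^ 2 - 1) * w - 4 * p^2 * (m - 1)^2 * u^2
          + p^3 * (m - 1)^2 * (m + p^2) * (v * z)"
        unfolding L three by simp
      have frac: "p / (m - p) = p * u" "p / (m ^ 2 - p) = p * w" "2 * p ^ 2 / (m - p ^ 2) = 2 * p ^ 2 * v"
          "(m + p ^ 2) / (m - p ^ 2) = (m + p ^ 2) * v" "p ^ 3 / (m ^ 2 - p ^ 3) = p ^ 3 * z"
        by (simp_all add: u_def v_def w_def z_def)
      show ?thesis unfolding L' frac by (simp add: algebra_simps power2_eq_square power3_eq_cube)
    qed
    ultimately show ?thesis using chi_mean_vertices_tendsto by (simp only:)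
  qed
  show ?thesis using lim2 lim1 lim0 unfolding m_def by blast
qed

end
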